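(* For all $A, B \in \mathbb{P}$, the spectral geometric mean $A \natural B$ is a midpoint of $A$ and $B$ with respect to the semi-metric $d$ on $\mathbb{P}$; that is, $$d(A, A \natural B) = d(B, A \natural B) = \tfrac{1}{2} d(A, B).$$
   Context: $\mathcal{H}$ is a Hilbert space, $B(\mathcal{H})$ is the space of bounded linear operators on $\mathcal{H}$ with operator norm $\Vert \cdot \Vert$, and $\mathbb{P} \subset B(\mathcal{H})$ is the open convex cone of positive definite (that is, self-adjoint, positive and invertible) operators. For $A, B \in \mathbb{P}$ the geometric mean is $A \# B := A^{1/2} (A^{-1/2} B A^{-1/2})^{1/2} A^{1/2}$ and the spectral geometric mean is $A \natural B := (A^{-1} \# B)^{1/2} A (A^{-1} \# B)^{1/2}$. The semi-metric is $d(A, B) := 2 \Vert \log (A^{-1} \# B) \Vert$. Powers and logarithms of positive definite operators are taken by functional calculus. *)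

theory Defs
  imports "HOL-Analysis.Analysis" "HOL-Computational_Algebra.Polynomial"
begin

text \<open>Scalar fields with a conjugation. A \<open>real_normed_field\<close> is isomorphic to the reals or the
  complex numbers (Gelfand--Mazur), and \<open>mult_kconj\<close> forces \<open>kconj\<close> to be the usual conjugation, so
  up to isomorphism the two instances below are the only ones.\<close>

class rc_field = real_normed_field +
  fixes kconj :: "'a \<Rightarrow> 'a"
  assumes kconj_add: "kconj (a + b) = kconj a + kconj b"
    and mult_kconj: "a * kconj a = (norm a)\<^sup>2 *\<^sub>R 1"

instantiation real :: rc_field
begin
definition kconj_real :: "real \<Rightarrow> real" where "kconj_real a = a"
instance by standard (simp_all add: kconj_real_def power2_eq_square)
end

instantiation complex :: rc_field
begin
definition kconj_complex :: "complex \<Rightarrow> complex" where "kconj_complex = cnj"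
instance
proof
  show "a * kconj a = (norm a)\<^sup>2 *\<^sub>R 1" for a :: complex
    unfolding kconj_complex_def scaleR_conv_of_real
    by (simp only: complex_norm_square mult_1_right)
qed (simp add: kconj_complex_def)
end

text \<open>A real or complex Hilbert space. The type class supplies the underlying real Hilbert space
  (completeness, norm and topology); the locale adds the scalar multiplication over \<open>'k\<close> and the
  \<open>'k\<close>-valued inner product, linear in the first argument, that induces the same norm.\<close>

locale hilbert_space = vector_space scale
  for scale :: "'k::rc_field \<Rightarrow> 'v::{real_inner, complete_space} \<Rightarrow> 'v" (infixr "*\<^sub>K" 75) +
  fixes ip :: "'v \<Rightarrow> 'v \<Rightarrow> 'k"
  assumes ip_add_left: "ip (x + y) z = ip x z + ip y z"
    and ip_scale_left: "ip (c *\<^sub>K x) y = c * ip x y"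
    and ip_commute: "ip y x = kconj (ip x y)"
    and ip_self: "ip x x = of_real ((norm x)\<^sup>2)"
begin

text \<open>\<open>B(H)\<close>: the norm of the blinfun type is the operator norm, and the elements of that type are
  the bounded operators that are linear over the reals.\<close>

definition bounded_ops :: "('v \<Rightarrow>\<^sub>L 'v) set" where
  "bounded_ops = {T :: 'v \<Rightarrow>\<^sub>L 'v. \<forall>c x. T (c *\<^sub>K x) = c *\<^sub>K T x}"

definition invertible_op :: "('v \<Rightarrow>\<^sub>L 'v) \<Rightarrow> bool" where
  "invertible_op T \<longleftrightarrow>
     (\<exists>S\<in>bounded_ops. S o\<^sub>L T = id_blinfun \<and> T o\<^sub>L S = id_blinfun)"

definition self_adjoint :: "('v \<Rightarrow>\<^sub>L 'v) \<Rightarrow> bool" where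
  "self_adjoint T \<longleftrightarrow> (\<forall>x y. ip (T x) y = ip x (T y))"

definition positive_op :: "('v \<Rightarrow>\<^sub>L 'v) \<Rightarrow> bool" where
  "positive_op T \<longleftrightarrow> (\<forall>x. \<exists>r\<ge>0. ip (T x) x = of_real r)"

definition posdef :: "('v \<Rightarrow>\<^sub>L 'v) set" where
  "posdef = {A \<in> bounded_ops. self_adjoint A \<and> positive_op A \<and> invertible_op A}"

definition spectrum :: "('v \<Rightarrow>\<^sub>L 'v) \<Rightarrow> 'k set" where
  "spectrum A = {z. \<not> invertible_op (A - Blinfun (\<lambda>x. z *\<^sub>K x))}"

definition poly_op :: "real poly \<Rightarrow> ('v \<Rightarrow>\<^sub>L 'v) \<Rightarrow> ('v \<Rightarrow>\<^sub>L 'v)" where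
  "poly_op p A = (\<Sum>i\<le>degree p. coeff p i *\<^sub>R (((\<lambda>T. A o\<^sub>L T) ^^ i) id_blinfun))"

text \<open>Continuous functional calculus of a self-adjoint operator, for real functions continuous on
  the spectrum (which is then real): the common norm limit of \<open>p\<^sub>n(A)\<close> over all sequences of real
  polynomials that converge to \<open>f\<close> uniformly on the spectrum.\<close>

definition fcalc :: "(real \<Rightarrow> real) \<Rightarrow> ('v \<Rightarrow>\<^sub>L 'v) \<Rightarrow> ('v \<Rightarrow>\<^sub>L 'v)" where
  "fcalc f A = (THE T. \<forall>p :: nat \<Rightarrow> real poly.
     uniform_limit {t. of_real t \<in> spectrum A} (\<lambda>n. poly (p n)) f sequentially
       \<longrightarrow> (\<lambda>n. poly_op (p n) A) \<longlonglongrightarrow> T)"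

definition op_powr :: "('v \<Rightarrow>\<^sub>L 'v) \<Rightarrow> real \<Rightarrow> ('v \<Rightarrow>\<^sub>L 'v)" where
  "op_powr A r = fcalc (\<lambda>t. t powr r) A"

definition op_log :: "('v \<Rightarrow>\<^sub>L 'v) \<Rightarrow> ('v \<Rightarrow>\<^sub>L 'v)" where
  "op_log A = fcalc ln A"

definition geo_mean :: "('v \<Rightarrow>\<^sub>L 'v) \<Rightarrow> ('v \<Rightarrow>\<^sub>L 'v) \<Rightarrow> ('v \<Rightarrow>\<^sub>L 'v)" where
  "geo_mean A B =
     op_powr A (1/2) o\<^sub>L
     op_powr (op_powr A (-1/2) o\<^sub>L B o\<^sub>L op_powr A (-1/2)) (1/2) o\<^sub>L
     op_powr A (1/2)"

definition spectral_mean :: "('v \<Rightarrow>\<^sub>L 'v) \<Rightarrow> ('v \<Rightarrow>\<^sub>L 'v) \<Rightarrow> ('v \<Rightarrow>\<^sub>L 'v)" where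
  "spectral_mean A B =
     op_powr (geo_mean (op_powr A (-1)) B) (1/2) o\<^sub>L A o\<^sub>L
     op_powr (geo_mean (op_powr A (-1)) B) (1/2)"

definition semi_metric :: "('v \<Rightarrow>\<^sub>L 'v) \<Rightarrow> ('v \<Rightarrow>\<^sub>L 'v) \<Rightarrow> real" where
  "semi_metric A B = 2 * norm (op_log (geo_mean (op_powr A (-1)) B))"

end

text \<open>Every real Hilbert space is an instance; so is the complex line.\<close>

lemma hilbert_space_real:
  "hilbert_space scaleR (inner :: 'v::{real_inner, complete_space} \<Rightarrow> 'v \<Rightarrow> real)"
proof unfold_locales
  show "y \<bullet> x = kconj (x \<bullet> y)" for x y :: 'v
    unfolding kconj_real_def by (rule inner_commute)
  show "x \<bullet> x = of_real ((norm x)\<^sup>2)" for x :: 'v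
    by (simp add: power2_norm_eq_inner)
qed (simp_all add: scaleR_add_left scaleR_add_right inner_add_left)

lemma hilbert_space_complex_line: "hilbert_space (*) (\<lambda>x y :: complex. x * cnj y)"
proof unfold_locales
  show "x * cnj x = of_real ((norm x)\<^sup>2)" for x :: complex
    by (rule complex_norm_square [symmetric])
qed (simp_all add: ring_distribs kconj_complex_def)

end

theory Submission
  imports Defs "HOL-Computational_Algebra.Fundamental_Theorem_Algebra"
begin

text \<open>The geometric mean \<open>C = A\<^sup>-\<^sup>1 # B\<close> is the unique positive definite solution of the Riccati equation
  \<open>C A C = B\<close>. With \<open>D = C\<^sup>1\<^sup>/\<^sup>2\<close> the spectral mean is \<open>G = D A D\<close>, and \<open>C A C = B\<close> gives
  \<open>G = D\<^sup>-\<^sup>1 B D\<^sup>-\<^sup>1\<close>. By uniqueness \<open>A\<^sup>-\<^sup>1 # G = D\<close> and \<open>B\<^sup>-\<^sup>1 # G = D\<^sup>-\<^sup>1\<close>, and the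
  logarithms of \<open>D\<close> and \<open>D\<^sup>-\<^sup>1\<close> are plus and minus half the logarithm of \<open>C\<close>.

  The functional calculus rests on the bound of the norm of \<open>p(A)\<close> by the supremum of \<open>|p|\<close> on the
  spectrum of \<open>A\<close>: plus or minus the norm of a self-adjoint operator lies in its spectrum, and if
  the real polynomial \<open>q\<close> does not vanish on the spectrum of \<open>A\<close>, then \<open>q(A)\<close> is invertible.\<close>

subsection \<open>Bounded operators and real polynomials\<close>

text \<open>The pointwise limit of a Cauchy sequence is again bounded, because the convergence is
  uniform relative to \<open>norm x\<close>. Completeness serves the fixed point argument for
  inverses and the limits that define the functional calculus.\<close>

lemma complete_UNIV_blinfun:
  "complete (UNIV :: ('a::real_normed_vector \<Rightarrow>\<^sub>L 'b::{real_normed_vector, complete_space}) set)"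
proof -
  have "\<exists>L. X \<longlonglongrightarrow> L" if "Cauchy X" for X :: "nat \<Rightarrow> 'a \<Rightarrow>\<^sub>L 'b"
  proof -
    have bound: "norm (X m x - X n x) \<le> norm (X m - X n) * norm x" for m n x
      using norm_blinfun[of "X m - X n" x] by (simp add: blinfun.diff_left)
    have "Cauchy (\<lambda>n. X n x)" for x
    proof (rule CauchyI)
      fix e :: real
      assume e: "0 < e"
      \<comment> \<open>The denominator \<open>norm x + 1\<close> keeps the quotient defined at
        \<open>x = 0\<close>.\<close>
      obtain M where M: "\<And>m n. m \<ge> M \<Longrightarrow> n \<ge> M \<Longrightarrow> norm (X m - X n) < e / (norm x + 1)"
        using CauchyD[OF \<open>Cauchy X\<close>, of "e / (norm x + 1)"] e by (auto simp: add_nonneg_pos)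
      have "norm (X m x - X n x) < e" if "m \<ge> M" "n \<ge> M" for m n
      proof -
        have "norm (X m x - X n x) \<le> norm (X m - X n) * (norm x + 1)"
          using bound[of m x n] by (simp add: distrib_left add_increasing2)
        also have "\<dots> < e"
          using M[OF that] by (simp add: pos_less_divide_eq add_nonneg_pos)
        finally show ?thesis .
      qed
      then show "\<exists>M. \<forall>m\<ge>M. \<forall>n\<ge>M. norm (X m x - X n x) < e"
        by blast
    qed
    then have "\<forall>x. \<exists>y. (\<lambda>n. X n x) \<longlonglongrightarrow> y"
      using Cauchy_convergent_iff convergent_def by blast
    then obtain v where v: "\<And>x. (\<lambda>n. X n x) \<longlonglongrightarrow> v x"
      by metis
    \<comment> \<open>Letting \<open>m\<close> tend to infinity in \<open>bound\<close> gives one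
      index that serves all \<open>x\<close>.\<close>
    have small: "\<exists>M. \<forall>n\<ge>M. \<forall>x. norm (X n x - v x) \<le> e * norm x" if e: "e > 0" for e
    proof -
      obtain M where M: "\<And>m n. m \<ge> M \<Longrightarrow> n \<ge> M \<Longrightarrow> norm (X m - X n) < e"
        using CauchyD[OF \<open>Cauchy X\<close> e] by blast
      have "norm (X n x - v x) \<le> e * norm x" if "n \<ge> M" for n x
      proof (rule tendsto_upperbound)
        show "(\<lambda>m. norm (X n x - X m x)) \<longlonglongrightarrow> norm (X n x - v x)"
          by (intro tendsto_intros v)
        show "\<forall>\<^sub>F m in sequentially. norm (X n x - X m x) \<le> e * norm x"
          using eventually_ge_at_top[of M]
        proof eventually_elim
          case (elim m)
          then have "norm (X n - X m) * norm x \<le> e * norm x"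
            using M[OF \<open>n \<ge> M\<close>, of m] by (simp add: mult_right_mono)
          then show ?case
            using bound[of n x m] by linarith
        qed
      qed simp
      then show ?thesis
        by blast
    qed
    have lin: "linear v"
    proof (rule linearI)
      show "v (x + y) = v x + v y" for x y
        using LIMSEQ_unique[OF v[of "x + y"]] tendsto_add[OF v[of x] v[of y]]
        by (simp add: blinfun.add_right)
      show "v (r *\<^sub>R x) = r *\<^sub>R v x" for r x
        using LIMSEQ_unique[OF v[of "r *\<^sub>R x"]] tendsto_scaleR[OF tendsto_const v[of x], of r]
        by (simp add: blinfun.scaleR_right)
    qed
    have "bounded_linear v"
    proof -
      obtain M where M: "\<And>n x. n \<ge> M \<Longrightarrow> norm (X n x - v x) \<le> 1 * norm x"
        using small[of 1] by auto
      have "norm (v x) \<le> norm x * (norm (X M) + 1)" for x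
        using norm_triangle_ineq3[of "X M x" "v x"] M[of M x] norm_blinfun[of "X M" x]
        by (simp add: algebra_simps)
      then show ?thesis
        using lin bounded_linear_axioms.intro by (auto simp: bounded_linear_def)
    qed
    then have V: "blinfun_apply (Blinfun v) = v"
      by (rule bounded_linear_Blinfun_apply)
    have "X \<longlonglongrightarrow> Blinfun v"
    proof (rule LIMSEQ_I)
      fix e :: real
      assume e: "0 < e"
      then obtain M where M: "\<And>n x. n \<ge> M \<Longrightarrow> norm (X n x - v x) \<le> (e/2) * norm x"
        using small[of "e/2"] by auto
      have "norm (X n - Blinfun v) \<le> e/2" if "n \<ge> M" for n
        by (rule norm_blinfun_bound) (use e M[OF that] in \<open>auto simp: blinfun.diff_left V\<close>)
      then show "\<exists>M. \<forall>n\<ge>M. norm (X n - Blinfun v) < e"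
        using e by (intro exI[of _ M]) fastforce
    qed
    then show ?thesis ..
  qed
  then show ?thesis
    by (simp add: complete_def)
qed

interpretation blinfun_compose: bounded_bilinear blinfun_compose
  by (rule bounded_bilinear_blinfun_compose)

lemma blinfun_compose_assoc: "(A o\<^sub>L B) o\<^sub>L C = A o\<^sub>L (B o\<^sub>L C)"
  by (rule blinfun_eqI) simp

lemma blinfun_compose_id [simp]: "id_blinfun o\<^sub>L A = A" "A o\<^sub>L id_blinfun = A"
  by (auto intro: blinfun_eqI)

lemma norm_blinfun_le_sqrt:
  fixes T :: "'a::real_normed_vector \<Rightarrow>\<^sub>L 'b::real_normed_vector"
  assumes "0 \<le> r" "\<And>x. (norm (T x))\<^sup>2 \<le> r * (norm x)\<^sup>2"
  shows "norm T \<le> sqrt r"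
proof (rule norm_blinfun_bound)
  show "norm (T x) \<le> sqrt r * norm x" for x
    using real_le_rsqrt[OF assms(2)[of x]] by (simp add: real_sqrt_mult)
qed (use assms in auto)

text \<open>An inverse is a fixed point of \<open>X \<mapsto> X - s (T X - I)\<close>, a contraction for small \<open>s > 0\<close>.\<close>

lemma coercive_invertible:
  fixes T :: "'a::{real_inner, complete_space} \<Rightarrow>\<^sub>L 'a"
  assumes c: "0 < c" and T: "\<And>x. c * (norm x)\<^sup>2 \<le> T x \<bullet> x"
  obtains S where "S o\<^sub>L T = id_blinfun" "T o\<^sub>L S = id_blinfun"
proof -
  define M where "M = norm T + c"
  have M: "0 < M" "norm T \<le> M" "c \<le> M"
    using c by (auto simp: M_def add_nonneg_pos)
  \<comment> \<open>This \<open>s\<close> minimises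
    \<open>1 - 2 * s * c + s\<^sup>2 * M\<^sup>2\<close>, which bounds the squared norm of
    \<open>id_blinfun - s *\<^sub>R T\<close>; the minimum is
    \<open>1 - c\<^sup>2 / M\<^sup>2\<close>.\<close>
  define s where "s = c / M\<^sup>2"
  have s: "0 < s"
    using c M by (simp add: s_def)
  define q where "q = norm (id_blinfun - s *\<^sub>R T)"
  have "q \<le> sqrt (1 - c\<^sup>2 / M\<^sup>2)"
    unfolding q_def
  proof (rule norm_blinfun_le_sqrt)
    show "0 \<le> 1 - c\<^sup>2 / M\<^sup>2"
      using M c by (simp add: power_mono)
    fix x
    have "(norm (T x))\<^sup>2 \<le> (M * norm x)\<^sup>2"
      using norm_blinfun[of T x] mult_right_mono[OF M(2), of "norm x"]
      by (intro power_mono) auto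
    then have "s\<^sup>2 * (norm (T x))\<^sup>2 \<le> s\<^sup>2 * (M * norm x)\<^sup>2"
      by (intro mult_left_mono) auto
    also have "\<dots> = c\<^sup>2 / M\<^sup>2 * (norm x)\<^sup>2"
      using M by (simp add: s_def power2_eq_square field_simps)
    finally have 1: "s\<^sup>2 * (norm (T x))\<^sup>2 \<le> c\<^sup>2 / M\<^sup>2 * (norm x)\<^sup>2" .
    have "s * (c * (norm x)\<^sup>2) \<le> s * (T x \<bullet> x)"
      using T s by (intro mult_left_mono) auto
    then have 2: "c\<^sup>2 / M\<^sup>2 * (norm x)\<^sup>2 \<le> s * (T x \<bullet> x)"
      by (simp add: s_def power2_eq_square)
    have "(norm (x - s *\<^sub>R T x))\<^sup>2 = (norm x)\<^sup>2 - 2 * (s * (T x \<bullet> x)) + s\<^sup>2 * (norm (T x))\<^sup>2"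
      using inner_commute[of x "T x"]
      unfolding power2_norm_eq_inner inner_diff_left inner_diff_right inner_scaleR_left inner_scaleR_right
      by (simp del: dot_square_norm add: power2_eq_square algebra_simps)
    with 1 2 show "(norm ((id_blinfun - s *\<^sub>R T) x))\<^sup>2 \<le> (1 - c\<^sup>2 / M\<^sup>2) * (norm x)\<^sup>2"
      by (simp add: blinfun.bilinear_simps algebra_simps)
  qed
  also have "\<dots> < 1"
    using c M by simp
  finally have q: "q < 1" .
  define F where "F X = X - s *\<^sub>R ((T o\<^sub>L X) - id_blinfun)" for X :: "'a \<Rightarrow>\<^sub>L 'a"
  have "dist (F X) (F Y) \<le> q * dist X Y" for X Y
  proof -
    have "F X - F Y = (id_blinfun - s *\<^sub>R T) o\<^sub>L (X - Y)"
      by (rule blinfun_eqI) (simp add: F_def blinfun.bilinear_simps algebra_simps)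
    then show ?thesis
      using norm_blinfun_compose by (auto simp: dist_norm q_def)
  qed
  then have "\<exists>!X. X \<in> UNIV \<and> F X = X"
    using q by (intro Banach_fix[OF complete_UNIV_blinfun, of q]) (auto simp: q_def)
  then obtain X where "F X = X"
    by blast
  then have TX: "T o\<^sub>L X = id_blinfun"
    using s by (simp add: F_def)
  \<comment> \<open>Coercivity makes \<open>T\<close> injective, so the right inverse is also a left
    inverse.\<close>
  have "(X o\<^sub>L T) x = x" for x
  proof -
    have "T (X (T x) - x) = 0"
      using fun_cong[OF arg_cong[OF TX, of blinfun_apply], of "T x"] by (simp add: blinfun.bilinear_simps)
    then have "c * (norm (X (T x) - x))\<^sup>2 \<le> 0"
      using T[of "X (T x) - x"] by simp
    then show ?thesis
      using c by (simp add: mult_le_0_iff)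
  qed
  then have "X o\<^sub>L T = id_blinfun"
    by (intro blinfun_eqI) simp
  with TX that show thesis
    by blast
qed

text \<open>Stone-Weierstrass, brought to the type \<open>real poly\<close> over which
  \<open>fcalc\<close> quantifies.\<close>

lemma Ex_poly_uniform_limit:
  assumes "compact S" "continuous_on S f"
  obtains p :: "nat \<Rightarrow> real poly" where "uniform_limit S (\<lambda>n. poly (p n)) f sequentially"
proof -
  obtain g where g: "uniform_limit S g f sequentially" "\<And>n. polynomial_function (g n)"
    using Stone_Weierstrass_uniform_limit[OF assms] by blast
  have "\<exists>p. poly p = g n" for n
  proof -
    obtain a k where "g n = (\<lambda>x. \<Sum>i\<le>k. a i * x ^ i)"
      using g(2)[of n] real_polynomial_function_eq real_polynomial_function_iff_sum by metis
    then have "poly (\<Sum>i\<le>k. monom (a i) i) = g n"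
      by (auto simp: poly_sum poly_monom)
    then show ?thesis ..
  qed
  then obtain p where "\<And>n. poly (p n) = g n"
    by metis
  with g that[of p] show thesis
    by simp
qed

text \<open>A complex root \<open>z\<close> of \<open>q\<close> is not real, and the factor is its
  minimal polynomial over the reals: the remainder of \<open>q\<close> has degree below 2 and
  vanishes at \<open>z\<close>, hence is zero.\<close>

lemma real_poly_quadratic_factor:
  fixes q :: "real poly"
  assumes "degree q > 0" and no_root: "\<And>x. poly q x \<noteq> 0"
  obtains a b g where "b \<noteq> 0" "q = [:a\<^sup>2 + b\<^sup>2, - 2 * a, 1:] * g"
proof -
  \<comment> \<open>\<open>e p z\<close> is the value of the real polynomial \<open>p\<close> at the
    complex point \<open>z\<close>.\<close>
  define e where "e p = poly (map_poly complex_of_real p)" for p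
  have [simp]: "e (pCons a p) z = of_real a + z * e p z" "e 0 z = 0" for a p z
    by (auto simp: e_def map_poly_pCons)
  have add: "e (p + r) z = e p z + e r z" for p r z
    by (induction p r rule: poly_induct2) (auto simp: algebra_simps)
  have smult: "e (smult a p) z = of_real a * e p z" for a p z
    by (induction p) (auto simp: algebra_simps)
  have mult: "e (p * r) z = e p z * e r z" for p r z
    by (induction p) (auto simp: algebra_simps add smult)
  have real: "e p (of_real x) = of_real (poly p x)" for p x
    by (induction p) auto
  have "degree (map_poly complex_of_real q) \<noteq> 0"
    using assms by (simp add: degree_map_poly)
  then obtain z where z: "e q z = 0"
    using fundamental_theorem_of_algebra constant_degree unfolding e_def by metis
  have Im: "Im z \<noteq> 0"
  proof
    assume "Im z = 0"
    then have "z = of_real (Re z)"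
      by (simp add: complex_eq_iff)
    then show False
      using z real[of q "Re z"] no_root[of "Re z"] by simp
  qed
  define d where "d = [:(Re z)\<^sup>2 + (Im z)\<^sup>2, - 2 * Re z, 1:]"
  have "e d z = 0"
    by (simp add: d_def complex_eq_iff power2_eq_square algebra_simps)
  then have "e (q mod d) z = 0"
    using z add[of "q div d * d" "q mod d" z] mult[of "q div d" d z] by simp
  moreover have "degree (q mod d) < 2"
    using degree_mod_less[of d q] by (auto simp: d_def)
  then have uv: "q mod d = [:coeff (q mod d) 0, coeff (q mod d) 1:]" (is "_ = [:?u, ?v:]")
    by (intro poly_eqI) (auto simp: coeff_pCons coeff_eq_0 numeral_2_eq_2 split: nat.splits)
  ultimately have "e [:?u, ?v:] z = 0"
    by metis
  \<comment> \<open>The imaginary part of \<open>?u + ?v * z\<close> is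
    \<open>?v * Im z\<close>.\<close>
  then have "?v = 0" "?u = 0"
    using Im by (auto simp: complex_eq_iff)
  then have "q mod d = 0"
    using uv by simp
  then have "q = d * (q div d)"
    by (metis add.right_neutral mult.commute div_mult_mod_eq)
  then show thesis
    using that[of "Im z" "Re z" "q div d"] Im by (simp add: d_def)
qed

subsection \<open>Operators on a Hilbert space\<close>

text \<open>The axiom \<open>mult_kconj\<close> determines the conjugate of a nonzero scalar; at
  zero additivity does. Multiplicativity can then be read off from the formula.\<close>

lemma kconj_eq: "kconj a = of_real ((norm a)\<^sup>2) / a" for a :: "'a::rc_field"
proof (cases "a = 0")
  case True
  then show ?thesis
    using kconj_add[of 0 "0::'a"] by simp
next
  case False
  then show ?thesis
    using mult_kconj[of a] by (simp add: scaleR_conv_of_real field_simps)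
qed

lemma kconj_mult: "kconj (a * b) = kconj a * kconj b" for a b :: "'a::rc_field"
  by (simp add: kconj_eq norm_mult power_mult_distrib)

lemma kconj_of_real: "kconj (of_real r) = (of_real r :: 'a::rc_field)"
  by (cases "r = 0") (simp_all add: kconj_eq power2_eq_square)

context hilbert_space
begin

section \<open>The scalar-valued and the real inner product\<close>

lemma ip_add_right: "ip x (y + z) = ip x y + ip x z"
  by (metis ip_commute ip_add_left kconj_add)

lemma ip_scale_right: "ip x (c *\<^sub>K y) = kconj c * ip x y"
  by (metis ip_commute ip_scale_left kconj_mult)

text \<open>Polarization: both inner products induce the same norm, so the real one is the real part
  of \<open>ip\<close>.\<close>

lemma of_real_inner: "of_real (2 * (x \<bullet> y)) = ip x y + ip y x"
proof -
  have "(norm (x + y))\<^sup>2 = (norm x)\<^sup>2 + 2 * (x \<bullet> y) + (norm y)\<^sup>2"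
    by (simp add: power2_norm_eq_inner inner_add inner_commute)
  then have "of_real (2 * (x \<bullet> y)) = ip (x + y) (x + y) - ip x x - ip y y"
    by (simp add: ip_self)
  then show ?thesis
    by (simp add: ip_add_left ip_add_right)
qed

text \<open>The locale does not postulate that the two scalar multiplications agree on real scalars;
  it follows by pairing both vectors with every \<open>y\<close>.\<close>

lemma scale_of_real: "of_real r *\<^sub>K x = r *\<^sub>R x"
proof -
  have "(of_real r *\<^sub>K x) \<bullet> y = (r *\<^sub>R x) \<bullet> y" for y
  proof -
    have "(of_real (2 * ((of_real r *\<^sub>K x) \<bullet> y)) :: 'k) = of_real (r * (2 * (x \<bullet> y)))"
      unfolding of_real_mult[of r] of_real_inner
      by (simp add: ip_scale_left ip_scale_right kconj_of_real distrib_left)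
    then show ?thesis
      unfolding of_real_eq_iff by simp
  qed
  then show ?thesis
    using vector_eq_rdot by blast
qed

lemma norm_scale: "norm (c *\<^sub>K x) = norm c * norm x"
proof -
  have "of_real ((norm (c *\<^sub>K x))\<^sup>2) = c * kconj c * ip x x"
    unfolding ip_self[symmetric] by (simp add: ip_scale_left ip_scale_right)
  also have "\<dots> = of_real ((norm c * norm x)\<^sup>2)"
    by (simp add: mult_kconj ip_self scaleR_conv_of_real power_mult_distrib)
  finally show ?thesis
    unfolding of_real_eq_iff by simp
qed

lemma bounded_linear_scale: "bounded_linear ((*\<^sub>K) c)"
proof (rule bounded_linear_intro)
  show "c *\<^sub>K (r *\<^sub>R x) = r *\<^sub>R (c *\<^sub>K x)" for r x
    by (simp add: mult.commute flip: scale_of_real)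
  show "norm (c *\<^sub>K x) \<le> norm x * norm c" for x
    by (simp add: norm_scale mult.commute)
qed (rule scale_right_distrib)

lemma Blinfun_scale_of_real: "Blinfun ((*\<^sub>K) (of_real r)) = r *\<^sub>R id_blinfun"
  by (rule blinfun_eqI)
    (simp add: bounded_linear_Blinfun_apply[OF bounded_linear_scale] scale_of_real blinfun.scaleR_left)

text \<open>Because the operators in question commute with scalars, self-adjointness and positivity can be
  tested with the real inner product.\<close>

lemma self_adjoint_iff_inner:
  assumes "A \<in> bounded_ops"
  shows "self_adjoint A \<longleftrightarrow> (\<forall>x y. A x \<bullet> y = x \<bullet> A y)"
proof
  assume "self_adjoint A"
  then have "(of_real (2 * (A x \<bullet> y)) :: 'k) = of_real (2 * (x \<bullet> A y))" for x y
    unfolding of_real_inner by (simp add: self_adjoint_def)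
  then show "\<forall>x y. A x \<bullet> y = x \<bullet> A y"
    unfolding of_real_eq_iff by simp
next
  assume A: "\<forall>x y. A x \<bullet> y = x \<bullet> A y"
  have "ip (A x) y = ip x (A y)" for x y
  proof -
    \<comment> \<open>Equality of the real inner products only equates real parts. Rotating
      \<open>x\<close> by the conjugate \<open>c\<close> of the defect \<open>z\<close> turns the
      defect into the real number \<open>c * z\<close>, the square of \<open>norm z\<close>, which
      must then vanish.\<close>
    define z where "z = ip (A x) y - ip x (A y)"
    define c where "c = kconj z"
    have "(of_real (2 * (A (c *\<^sub>K x) \<bullet> y)) :: 'k) = of_real (2 * ((c *\<^sub>K x) \<bullet> A y))"
      using A by simp
    then have "c * ip (A x) y + kconj c * ip y (A x) = c * ip x (A y) + kconj c * ip (A y) x"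
      using assms unfolding of_real_inner bounded_ops_def by (simp add: ip_scale_left ip_scale_right)
    then have "c * z + kconj c * (ip y (A x) - ip (A y) x) = 0"
      by (simp add: z_def algebra_simps)
    moreover have "ip y (A x) = kconj (ip (A x) y)" "ip (A y) x = kconj (ip x (A y))"
      by (rule ip_commute)+
    moreover have "kconj (u - v) = kconj u - kconj v" for u v :: 'k
      using kconj_add[of "u - v" v] by simp
    ultimately have "c * z + kconj (c * z) = 0"
      by (simp add: z_def kconj_mult)
    moreover have "c * z = of_real ((norm z)\<^sup>2)"
      using mult_kconj[of z] by (simp add: c_def mult.commute scaleR_conv_of_real)
    ultimately have "(of_real (2 * (norm z)\<^sup>2) :: 'k) = of_real 0"
      by (simp only: kconj_of_real) simp
    then show ?thesis
      unfolding of_real_eq_iff by (simp add: z_def)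
  qed
  then show "self_adjoint A"
    by (simp add: self_adjoint_def)
qed

lemma positive_op_iff_inner:
  assumes "self_adjoint A"
  shows "positive_op A \<longleftrightarrow> (\<forall>x. 0 \<le> A x \<bullet> x)"
proof -
  have *: "ip (A x) x = of_real (A x \<bullet> x)" for x
  proof -
    have "ip x (A x) = ip (A x) x"
      using assms by (simp add: self_adjoint_def)
    then show ?thesis
      using of_real_inner[of "A x" x] by simp
  qed
  show ?thesis
    unfolding positive_op_def * of_real_eq_iff by auto
qed

text \<open>By \<open>self_adjoint_iff_inner\<close> these are the self-adjoint elements of
  \<open>bounded_ops\<close>, stated through the real inner product so that no computation has to
  mention \<open>ip\<close>.\<close>

definition sa_ops :: "('v \<Rightarrow>\<^sub>L 'v) set" where
  "sa_ops = {A \<in> bounded_ops. \<forall>x y. A x \<bullet> y = x \<bullet> A y}"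

lemma posdef_iff: "A \<in> posdef \<longleftrightarrow> A \<in> sa_ops \<and> (\<forall>x. 0 \<le> A x \<bullet> x) \<and> invertible_op A"
  unfolding posdef_def sa_ops_def using self_adjoint_iff_inner positive_op_iff_inner by blast

lemma sa_inner: "A \<in> sa_ops \<Longrightarrow> A x \<bullet> y = x \<bullet> A y"
  by (simp add: sa_ops_def)

section \<open>Closure properties of the self-adjoint operators\<close>

lemma bounded_ops_add: "A \<in> bounded_ops \<Longrightarrow> B \<in> bounded_ops \<Longrightarrow> A + B \<in> bounded_ops"
  by (simp add: bounded_ops_def blinfun.add_left scale_right_distrib)

lemma bounded_ops_scaleR: "A \<in> bounded_ops \<Longrightarrow> r *\<^sub>R A \<in> bounded_ops"
  by (simp add: bounded_ops_def blinfun.scaleR_left mult.commute flip: scale_of_real)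

lemma bounded_ops_compose: "A \<in> bounded_ops \<Longrightarrow> B \<in> bounded_ops \<Longrightarrow> A o\<^sub>L B \<in> bounded_ops"
  by (simp add: bounded_ops_def)

lemma id_sa_ops: "id_blinfun \<in> sa_ops"
  by (simp add: sa_ops_def bounded_ops_def)

lemma sa_ops_add: "A \<in> sa_ops \<Longrightarrow> B \<in> sa_ops \<Longrightarrow> A + B \<in> sa_ops"
  by (simp add: sa_ops_def bounded_ops_add blinfun.add_left inner_add)

lemma sa_ops_scaleR: "A \<in> sa_ops \<Longrightarrow> r *\<^sub>R A \<in> sa_ops"
  by (simp add: sa_ops_def bounded_ops_scaleR blinfun.scaleR_left)

lemma sa_ops_diff: "A \<in> sa_ops \<Longrightarrow> B \<in> sa_ops \<Longrightarrow> A - B \<in> sa_ops"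
  using sa_ops_add[of A "(-1) *\<^sub>R B"] sa_ops_scaleR[of B "-1"] by simp

lemma sa_ops_compose:
  "A \<in> sa_ops \<Longrightarrow> B \<in> sa_ops \<Longrightarrow> A o\<^sub>L B = B o\<^sub>L A \<Longrightarrow> A o\<^sub>L B \<in> sa_ops"
  unfolding sa_ops_def using bounded_ops_compose[of A B]
  by simp (metis blinfun_apply_blinfun_compose)

lemma sa_ops_sandwich: "A \<in> sa_ops \<Longrightarrow> B \<in> sa_ops \<Longrightarrow> A o\<^sub>L B o\<^sub>L A \<in> sa_ops"
  by (simp add: sa_ops_def bounded_ops_compose)

lemma sa_ops_LIMSEQ:
  assumes "\<And>n. X n \<in> sa_ops" "X \<longlonglongrightarrow> T"
  shows "T \<in> sa_ops"
proof -
  have lim: "(\<lambda>n. X n x) \<longlonglongrightarrow> T x" for x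
    by (intro tendsto_intros assms(2))
  have "T (c *\<^sub>K x) = c *\<^sub>K T x" for c x
    using LIMSEQ_unique[OF lim[of "c *\<^sub>K x"]] bounded_linear.tendsto[OF bounded_linear_scale lim] assms(1)
    by (simp add: sa_ops_def bounded_ops_def)
  moreover have "T x \<bullet> y = x \<bullet> T y" for x y
    using LIMSEQ_unique[OF tendsto_inner[OF lim[of x] tendsto_const[of y]]]
      tendsto_inner[OF tendsto_const[of x] lim[of y]] assms(1) by (simp add: sa_inner)
  ultimately show ?thesis
    by (simp add: sa_ops_def bounded_ops_def)
qed

section \<open>Criteria for invertibility\<close>

lemma invertible_opI:
  assumes "T \<in> bounded_ops" and ST: "S o\<^sub>L T = id_blinfun" and TS: "T o\<^sub>L S = id_blinfun"
  shows "invertible_op T"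
proof -
  \<comment> \<open>\<open>invertible_op\<close> asks for an inverse in \<open>bounded_ops\<close>;
    a two-sided inverse inherits linearity over the scalars from \<open>T\<close>.\<close>
  have "S (c *\<^sub>K x) = c *\<^sub>K S x" for c x
  proof -
    have 1: "T (S y) = y" "S (T y) = y" for y
      using arg_cong[OF TS, of "\<lambda>X. X y"] arg_cong[OF ST, of "\<lambda>X. X y"] by simp_all
    have "S (c *\<^sub>K x) = S (T (c *\<^sub>K S x))"
      using assms(1) by (simp add: bounded_ops_def 1)
    then show ?thesis
      by (simp add: 1)
  qed
  then show ?thesis
    using assms unfolding invertible_op_def bounded_ops_def by blast
qed

lemma invertible_op_coercive:
  assumes "T \<in> bounded_ops" "0 < c" "\<And>x. c * (norm x)\<^sup>2 \<le> T x \<bullet> x"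
  shows "invertible_op T"
  using coercive_invertible[OF assms(2,3)] invertible_opI[OF assms(1)] by blast

lemma invertible_op_compose:
  assumes "invertible_op A" "invertible_op B"
  shows "invertible_op (A o\<^sub>L B)"
proof -
  obtain S T where S: "S \<in> bounded_ops" "S o\<^sub>L A = id_blinfun" "A o\<^sub>L S = id_blinfun"
    and T: "T \<in> bounded_ops" "T o\<^sub>L B = id_blinfun" "B o\<^sub>L T = id_blinfun"
    using assms unfolding invertible_op_def by blast
  have "(T o\<^sub>L S) o\<^sub>L (A o\<^sub>L B) = id_blinfun" "(A o\<^sub>L B) o\<^sub>L (T o\<^sub>L S) = id_blinfun"
    by (metis S T blinfun_compose_assoc blinfun_compose_id)+
  then show ?thesis
    unfolding invertible_op_def using bounded_ops_compose S T by blast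
qed

text \<open>If \<open>S\<close> inverts the product, then \<open>S o\<^sub>L B\<close> is a left
  inverse and \<open>B o\<^sub>L S\<close> a right inverse of \<open>A\<close>, so the two
  coincide.\<close>

lemma invertible_op_left_factor:
  assumes "A \<in> bounded_ops" "A o\<^sub>L B = B o\<^sub>L A" "invertible_op (A o\<^sub>L B)"
  shows "invertible_op A"
proof -
  obtain S where S: "S o\<^sub>L (A o\<^sub>L B) = id_blinfun" "(A o\<^sub>L B) o\<^sub>L S = id_blinfun"
    using assms(3) unfolding invertible_op_def by blast
  from S have "(S o\<^sub>L B) o\<^sub>L A = id_blinfun" "A o\<^sub>L (B o\<^sub>L S) = id_blinfun"
    using assms(2) by (metis blinfun_compose_assoc)+
  moreover from this have "S o\<^sub>L B = B o\<^sub>L S"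
    by (metis blinfun_compose_assoc blinfun_compose_id)
  ultimately show ?thesis
    using invertible_opI[OF assms(1)] by simp
qed

lemma invertible_op_scaleR:
  assumes "r \<noteq> 0" "invertible_op A"
  shows "invertible_op (r *\<^sub>R A)"
proof -
  obtain S where "S \<in> bounded_ops" "S o\<^sub>L A = id_blinfun" "A o\<^sub>L S = id_blinfun"
    using assms(2) unfolding invertible_op_def by blast
  then show ?thesis
    unfolding invertible_op_def using assms(1) bounded_ops_scaleR
    by (intro bexI[of _ "inverse r *\<^sub>R S"])
      (auto simp: blinfun_compose.scaleR_left blinfun_compose.scaleR_right)
qed

text \<open>The square of \<open>T\<close> is coercive, since its quadratic form at \<open>x\<close>
  is the square of \<open>norm (T x)\<close>; then \<open>T\<close> is invertible as a factor of its
  square.\<close>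

lemma invertible_op_bounded_below:
  assumes "T \<in> sa_ops" "0 < c" "\<And>x. c * norm x \<le> norm (T x)"
  shows "invertible_op T"
proof (rule invertible_op_left_factor)
  show "invertible_op (T o\<^sub>L T)"
  proof (rule invertible_op_coercive)
    show "c\<^sup>2 * (norm x)\<^sup>2 \<le> (T o\<^sub>L T) x \<bullet> x" for x
      using power_mono[OF assms(3)[of x], of 2] assms sa_inner[OF assms(1), of "T x" x]
      by (simp add: power_mult_distrib power2_norm_eq_inner)
  qed (use assms in \<open>auto simp: sa_ops_def bounded_ops_compose\<close>)
qed (use assms in \<open>auto simp: sa_ops_def\<close>)

lemma invertible_op_imp_bounded_below:
  assumes "invertible_op T"
  shows "\<exists>c>0. \<forall>x. c * norm x \<le> norm (T x)"
proof -
  obtain S where S: "S o\<^sub>L T = id_blinfun"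
    using assms unfolding invertible_op_def by blast
  have "norm x \<le> norm (T x) * (norm S + 1)" for x
  proof -
    have "S (T x) = x"
      using arg_cong[OF S, of "\<lambda>X. X x"] by simp
    then show ?thesis
      using norm_blinfun[of S "T x"] by (simp add: algebra_simps add_increasing)
  qed
  then show ?thesis
    by (intro exI[of _ "1 / (norm S + 1)"]) (simp add: pos_divide_le_eq add_nonneg_pos)
qed

text \<open>This is the set on which \<open>fcalc\<close> demands uniform convergence.\<close>

definition rspec :: "('v \<Rightarrow>\<^sub>L 'v) \<Rightarrow> real set" where
  "rspec A = {t. of_real t \<in> spectrum A}"

lemma rspec_iff: "t \<in> rspec A \<longleftrightarrow> \<not> invertible_op (A - t *\<^sub>R id_blinfun)"
  by (simp add: rspec_def spectrum_def Blinfun_scale_of_real)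

lemma invertible_op_id: "invertible_op id_blinfun"
  using id_sa_ops by (intro invertible_opI) (auto simp: sa_ops_def)

lemma sa_ops_minus_id: "A \<in> sa_ops \<Longrightarrow> A - t *\<^sub>R id_blinfun \<in> sa_ops"
  by (intro sa_ops_diff sa_ops_scaleR id_sa_ops)

subsection \<open>Polynomials of an operator\<close>

lemma poly_op_eq_sum:
  assumes "degree p \<le> n"
  shows "poly_op p A = (\<Sum>i\<le>n. coeff p i *\<^sub>R (((\<lambda>T. A o\<^sub>L T) ^^ i) id_blinfun))"
  unfolding poly_op_def using assms by (intro sum.mono_neutral_left) (auto intro: coeff_eq_0)

text \<open>The Horner recursion, from which the algebraic laws of \<open>poly_op\<close> follow by
  induction on the polynomial.\<close>

lemma poly_op_pCons: "poly_op (pCons a p) A = a *\<^sub>R id_blinfun + (A o\<^sub>L poly_op p A)"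
proof -
  \<comment> \<open>The sum runs to \<open>Suc (degree p)\<close> even for \<open>p = 0\<close>,
    where the degree of \<open>pCons a p\<close> is smaller.\<close>
  have "poly_op (pCons a p) A =
      (\<Sum>i\<le>Suc (degree p). coeff (pCons a p) i *\<^sub>R (((\<lambda>T. A o\<^sub>L T) ^^ i) id_blinfun))"
    by (rule poly_op_eq_sum[OF degree_pCons_le])
  also have "\<dots> = a *\<^sub>R id_blinfun + (A o\<^sub>L poly_op p A)"
    unfolding sum.atMost_Suc_shift
    by (simp add: poly_op_def blinfun_compose.sum_right blinfun_compose.scaleR_right)
  finally show ?thesis .
qed

lemma poly_op_0 [simp]: "poly_op 0 A = 0"
  by (simp add: poly_op_def)

lemma poly_op_add: "poly_op (p + q) A = poly_op p A + poly_op q A"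
  by (induction p q rule: poly_induct2)
    (simp_all add: poly_op_pCons blinfun_compose.add_right scaleR_add_left)

lemma poly_op_smult: "poly_op (smult c p) A = c *\<^sub>R poly_op p A"
  by (induction p) (simp_all add: poly_op_pCons blinfun_compose.scaleR_right scaleR_add_right)

lemma poly_op_diff: "poly_op (p - q) A = poly_op p A - poly_op q A"
  using poly_op_add[of p "smult (-1) q" A] poly_op_smult[of "-1" q A] by simp

lemma poly_op_mult: "poly_op (p * q) A = poly_op p A o\<^sub>L poly_op q A"
  by (induction p)
    (simp_all add: poly_op_pCons poly_op_add poly_op_smult blinfun_compose.add_left
      blinfun_compose.scaleR_left blinfun_compose.zero_left blinfun_compose_assoc)

lemma poly_op_const: "poly_op [:c:] A = c *\<^sub>R id_blinfun"
  by (simp add: poly_op_pCons blinfun_compose.zero_right)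

lemma poly_op_ident: "poly_op [:0, 1:] A = A"
  by (simp add: poly_op_pCons blinfun_compose.zero_right)

lemma poly_op_linear: "poly_op [:a, 1:] A = A + a *\<^sub>R id_blinfun"
  by (simp add: poly_op_pCons blinfun_compose.zero_right)

lemma poly_op_commute: "poly_op p A o\<^sub>L poly_op q A = poly_op q A o\<^sub>L poly_op p A"
  by (metis poly_op_mult mult.commute)

lemma poly_op_sa_ops:
  assumes "A \<in> sa_ops"
  shows "poly_op p A \<in> sa_ops"
proof (induction p)
  case 0
  show ?case
    using sa_ops_scaleR[OF id_sa_ops, of 0] by simp
next
  case (pCons a p)
  have "A o\<^sub>L poly_op p A = poly_op p A o\<^sub>L A"
    using poly_op_commute[of "[:0, 1:]" A p] by (simp only: poly_op_ident)
  with pCons assms show ?case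
    unfolding poly_op_pCons by (intro sa_ops_add sa_ops_scaleR id_sa_ops sa_ops_compose)
qed

text \<open>Over the reals a polynomial splits into linear factors, whose roots avoid the spectrum, and
  quadratic factors \<open>(t - a)\<^sup>2 + b\<^sup>2\<close>, which are coercive at a self-adjoint operator.\<close>

lemma poly_op_invertible:
  assumes A: "A \<in> sa_ops"
    and "q \<noteq> 0" "\<And>t. t \<in> rspec A \<Longrightarrow> poly q t \<noteq> 0"
  shows "invertible_op (poly_op q A)"
  using assms(2,3)
proof (induction "degree q" arbitrary: q rule: less_induct)
  case less
  consider (const) "degree q = 0" | (root) x where "poly q x = 0"
    | (quadr) "degree q > 0" "\<And>x. poly q x \<noteq> 0"
    by blast
  then show ?case
  proof cases
    case const
    then obtain c where "q = [:c:]"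
      by (rule degree_eq_zeroE)
    then show ?thesis
      using less.prems by (simp add: poly_op_const invertible_op_scaleR invertible_op_id)
  next
    case root
    then obtain g where g: "q = [:-x, 1:] * g"
      by (auto simp: poly_eq_0_iff_dvd elim: dvdE)
    then have "g \<noteq> 0"
      using less.prems by auto
    then have "degree g < degree q"
      unfolding g by (subst degree_mult_eq) auto
    then have "invertible_op (poly_op g A)"
      using less.hyps \<open>g \<noteq> 0\<close> less.prems(2) g by auto
    moreover have "invertible_op (poly_op [:-x, 1:] A)"
      using root less.prems(2)[of x] by (auto simp: rspec_iff poly_op_linear)
    ultimately show ?thesis
      unfolding g poly_op_mult by (intro invertible_op_compose)
  next
    case quadr
    then obtain a b g where b: "b \<noteq> 0" and g: "q = [:a\<^sup>2 + b\<^sup>2, - 2 * a, 1:] * g"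
      by (rule real_poly_quadratic_factor)
    then have "g \<noteq> 0"
      using less.prems by auto
    then have "degree g < degree q"
      unfolding g by (subst degree_mult_eq) auto
    moreover have "poly g t \<noteq> 0" if "t \<in> rspec A" for t
      using less.prems(2)[OF that] unfolding g poly_mult by auto
    ultimately have "invertible_op (poly_op g A)"
      using less.hyps \<open>g \<noteq> 0\<close> by blast
    moreover have "invertible_op (poly_op [:a\<^sup>2 + b\<^sup>2, - 2 * a, 1:] A)"
    proof (rule invertible_op_coercive)
      show "poly_op [:a\<^sup>2 + b\<^sup>2, - 2 * a, 1:] A \<in> bounded_ops"
        using poly_op_sa_ops[OF A] by (simp add: sa_ops_def)
      fix x
      have "poly_op [:a\<^sup>2 + b\<^sup>2, - 2 * a, 1:] A x \<bullet> x = (norm (A x - a *\<^sub>R x))\<^sup>2 + b\<^sup>2 * (norm x)\<^sup>2"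
        using sa_inner[OF A, of "A x" x] sa_inner[OF A, of x x] unfolding power2_norm_eq_inner
        by (simp add: poly_op_pCons blinfun.bilinear_simps inner_simps power2_eq_square algebra_simps
            inner_commute del: dot_square_norm)
      then show "b\<^sup>2 * (norm x)\<^sup>2 \<le> poly_op [:a\<^sup>2 + b\<^sup>2, - 2 * a, 1:] A x \<bullet> x"
        by simp
    qed (use b in simp)
    ultimately show ?thesis
      unfolding g poly_op_mult by (intro invertible_op_compose)
  qed
qed

section \<open>Norm bounds from the real spectrum\<close>

lemma norm_in_rspec:
  assumes T: "T \<in> sa_ops" and "T \<noteq> 0"
  shows "norm T \<in> rspec T \<or> - norm T \<in> rspec T"
proof (rule ccontr)
  define n where "n = norm T"
  have n: "0 < n"
    using assms by (simp add: n_def)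
  assume "\<not> ?thesis"
  \<comment> \<open>Otherwise \<open>T\<^sup>2 - n\<^sup>2\<close> is invertible, hence bounded
    below by some \<open>c > 0\<close>. Expanding the square of its norm at \<open>x\<close>
    improves the bound of \<open>T\<close> strictly below its operator norm
    \<open>n\<close>.\<close>
  then have inv: "invertible_op ((T - n *\<^sub>R id_blinfun) o\<^sub>L (T - (- n) *\<^sub>R id_blinfun))"
    by (intro invertible_op_compose) (auto simp: rspec_iff n_def)
  obtain c where c: "0 < c"
      "\<And>x. c * norm x \<le> norm (((T - n *\<^sub>R id_blinfun) o\<^sub>L (T - (- n) *\<^sub>R id_blinfun)) x)"
    using invertible_op_imp_bounded_below[OF inv] by blast
  have ineq: "(norm (T x))\<^sup>2 \<le> (n\<^sup>2 - c\<^sup>2 / n\<^sup>2) * (norm x)\<^sup>2" for x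
  proof -
    have "((T - n *\<^sub>R id_blinfun) o\<^sub>L (T - (- n) *\<^sub>R id_blinfun)) x = T (T x) - n\<^sup>2 *\<^sub>R x"
      by (simp add: blinfun.bilinear_simps power2_eq_square scaleR_right_diff_distrib)
    then have "(c * norm x)\<^sup>2 \<le> (norm (T (T x) - n\<^sup>2 *\<^sub>R x))\<^sup>2"
      using c(1) c(2)[of x] by (intro power_mono) auto
    also have "\<dots> = (norm (T (T x)))\<^sup>2 - 2 * n\<^sup>2 * (norm (T x))\<^sup>2 + n^4 * (norm x)\<^sup>2"
      using sa_inner[OF T, of "T x" x] sa_inner[OF T, of x "T x"] unfolding power2_norm_eq_inner
      by (simp add: inner_simps algebra_simps inner_commute power2_eq_square power4_eq_xxxx
          del: dot_square_norm)
    also have "\<dots> \<le> (n * norm (T x))\<^sup>2 - 2 * n\<^sup>2 * (norm (T x))\<^sup>2 + n^4 * (norm x)\<^sup>2"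
      using norm_blinfun[of T "T x"] by (auto intro!: power_mono simp: n_def)
    finally have "n\<^sup>2 * (norm (T x))\<^sup>2 \<le> (n^4 - c\<^sup>2) * (norm x)\<^sup>2"
      by (simp add: power_mult_distrib algebra_simps)
    also have "\<dots> = n\<^sup>2 * ((n\<^sup>2 - c\<^sup>2 / n\<^sup>2) * (norm x)\<^sup>2)"
      using n by (simp add: field_simps power2_eq_square power4_eq_xxxx)
    finally show ?thesis
      using n by simp
  qed
  \<comment> \<open>A vector outside the kernel shows that the improved constant is nonnegative, so
    its square root bounds the norm.\<close>
  obtain x where "T x \<noteq> 0"
    using \<open>T \<noteq> 0\<close> by (metis blinfun_eqI blinfun.zero_left)
  then have "0 < (n\<^sup>2 - c\<^sup>2 / n\<^sup>2) * (norm x)\<^sup>2"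
    using ineq[of x] by (smt (verit) norm_eq_zero zero_less_power2)
  then have "0 \<le> n\<^sup>2 - c\<^sup>2 / n\<^sup>2"
    by (simp add: zero_less_mult_iff)
  then have "n \<le> sqrt (n\<^sup>2 - c\<^sup>2 / n\<^sup>2)"
    unfolding n_def using ineq by (intro norm_blinfun_le_sqrt) (auto simp: n_def)
  then have "n\<^sup>2 \<le> n\<^sup>2 - c\<^sup>2 / n\<^sup>2"
    using n \<open>0 \<le> n\<^sup>2 - c\<^sup>2 / n\<^sup>2\<close> by (metis less_imp_le power_mono real_sqrt_pow2)
  then show False
    using c n by (simp add: divide_le_0_iff)
qed

text \<open>The second hypothesis excludes the zero space, on which every operator is invertible and
  spectra are empty.\<close>

lemma rspec_nonempty:
  assumes "A \<in> sa_ops" "(id_blinfun :: 'v \<Rightarrow>\<^sub>L 'v) \<noteq> 0"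
  shows "rspec A \<noteq> {}"
proof (cases "A = 0")
  case True
  have "0 \<in> rspec A"
    using assms(2) True by (auto simp: rspec_iff invertible_op_def blinfun_compose.zero_right)
  then show ?thesis
    by blast
next
  case False
  then show ?thesis
    using norm_in_rspec[OF assms(1)] by blast
qed

text \<open>Up to sign the norm is a spectral value \<open>s\<close> of \<open>poly_op p A\<close>.
  As \<open>poly_op (p - [:s:]) A\<close> is not invertible, \<open>p\<close> takes the value
  \<open>s\<close> on the spectrum of \<open>A\<close>.\<close>

lemma norm_poly_op_le:
  assumes A: "A \<in> sa_ops" and "0 \<le> e" and e: "\<And>t. t \<in> rspec A \<Longrightarrow> \<bar>poly p t\<bar> \<le> e"
  shows "norm (poly_op p A) \<le> e"
proof (cases "poly_op p A = 0")
  case True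
  then show ?thesis
    using assms by simp
next
  case False
  then obtain s where s: "s \<in> rspec (poly_op p A)" "\<bar>s\<bar> = norm (poly_op p A)"
    using norm_in_rspec[OF poly_op_sa_ops[OF A]] by (metis abs_minus abs_norm_cancel)
  have "\<exists>t\<in>rspec A. poly p t = s"
  \<comment> \<open>For this constant \<open>p\<close> the difference \<open>p - [:s:]\<close> is
    the zero polynomial, and a point of the spectrum has to come from its nonemptiness.\<close>
  proof (cases "p = [:s:]")
    case True
    have "(id_blinfun :: 'v \<Rightarrow>\<^sub>L 'v) \<noteq> 0"
      using False by (metis blinfun_compose.zero_left blinfun_compose_id(1))
    then show ?thesis
      using rspec_nonempty[OF A] True by auto
  next
    case False
    then have "\<exists>t\<in>rspec A. poly (p - [:s:]) t = 0"
      using poly_op_invertible[OF A, of "p - [:s:]"] s(1)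
      unfolding rspec_iff[of s] poly_op_diff poly_op_const by fastforce
    then show ?thesis
      by auto
  qed
  then show ?thesis
    using e s by metis
qed

text \<open>Values beyond \<open>norm A\<close> leave \<open>A - t *\<^sub>R id_blinfun\<close>
  bounded below, and a lower bound \<open>c\<close> at \<open>t\<close> survives any shift of
  \<open>t\<close> by less than \<open>c\<close>.\<close>

lemma compact_rspec:
  assumes A: "A \<in> sa_ops"
  shows "compact (rspec A)"
proof -
  have "\<bar>t\<bar> \<le> norm A" if "t \<in> rspec A" for t
  proof (rule ccontr)
    assume t: "\<not> ?thesis"
    have "(\<bar>t\<bar> - norm A) * norm x \<le> norm ((A - t *\<^sub>R id_blinfun) x)" for x
      using norm_blinfun[of A x] norm_triangle_ineq2[of "t *\<^sub>R x" "A x"]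
      by (simp add: blinfun.bilinear_simps algebra_simps norm_minus_commute)
    then show False
      using invertible_op_bounded_below[OF sa_ops_minus_id[OF A], of "\<bar>t\<bar> - norm A"] t that
      by (auto simp: rspec_iff)
  qed
  then have "bounded (rspec A)"
    by (auto simp: bounded_iff)
  moreover have "open (- rspec A)"
    unfolding open_dist
  proof safe
    fix t
    assume "t \<notin> rspec A"
    then obtain c where c: "0 < c" "\<And>x. c * norm x \<le> norm ((A - t *\<^sub>R id_blinfun) x)"
      by (metis rspec_iff invertible_op_imp_bounded_below)
    have False if "dist s t < c" "s \<in> rspec A" for s
    proof -
      have "(c - \<bar>s - t\<bar>) * norm x \<le> norm ((A - s *\<^sub>R id_blinfun) x)" for x
      proof -
        have eq: "A x - t *\<^sub>R x = (A x - s *\<^sub>R x) - (t - s) *\<^sub>R x"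
          by (simp add: algebra_simps)
        have "norm (A x - t *\<^sub>R x) \<le> norm (A x - s *\<^sub>R x) + \<bar>t - s\<bar> * norm x"
          unfolding eq using norm_triangle_ineq4[of "A x - s *\<^sub>R x" "(t - s) *\<^sub>R x"]
          by (simp only: norm_scaleR real_norm_def)
        then show ?thesis
          using c(2)[of x] by (simp add: blinfun.bilinear_simps left_diff_distrib abs_minus_commute)
      qed
      then show False
        using invertible_op_bounded_below[OF sa_ops_minus_id[OF A], of "c - \<bar>s - t\<bar>"] that
        by (auto simp: rspec_iff dist_real_def)
    qed
    then show "\<exists>e>0. \<forall>s. dist s t < e \<longrightarrow> s \<in> - rspec A"
      using c by blast
  qed
  ultimately show ?thesis
    by (simp add: compact_eq_bounded_closed closed_def)
qed

subsection \<open>The continuous functional calculus\<close>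

text \<open>The limit of the \<open>poly_op (p n) A\<close> cannot depend on the approximating
  sequence.\<close>

lemma poly_op_diff_LIMSEQ:
  assumes A: "A \<in> sa_ops"
    and p: "uniform_limit (rspec A) (\<lambda>n. poly (p n)) f sequentially"
    and q: "uniform_limit (rspec A) (\<lambda>n. poly (q n)) f sequentially"
  shows "(\<lambda>n. poly_op (p n) A - poly_op (q n) A) \<longlonglongrightarrow> 0"
proof (rule tendstoI)
  fix e :: real
  assume e: "0 < e"
  have "uniform_limit (rspec A) (\<lambda>n t. poly (p n) t - poly (q n) t) (\<lambda>t. f t - f t) sequentially"
    by (intro uniform_limit_intros p q)
  then have "\<forall>\<^sub>F n in sequentially. \<forall>t\<in>rspec A. \<bar>poly (p n - q n) t\<bar> < e/2"
    using e by (auto dest!: uniform_limitD[where e = "e/2"] simp: dist_real_def)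
  then show "\<forall>\<^sub>F n in sequentially. dist (poly_op (p n) A - poly_op (q n) A) 0 < e"
  proof eventually_elim
    case (elim n)
    then have "norm (poly_op (p n - q n) A) \<le> e/2"
      using e by (intro norm_poly_op_le A) (auto intro: less_imp_le)
    then show ?case
      using e by (simp add: poly_op_diff)
  qed
qed

lemma poly_op_Cauchy:
  assumes A: "A \<in> sa_ops"
    and p: "uniform_limit (rspec A) (\<lambda>n. poly (p n)) f sequentially"
  shows "Cauchy (\<lambda>n. poly_op (p n) A)"
proof (rule metric_CauchyI)
  fix e :: real
  assume e: "0 < e"
  obtain M where M: "\<And>n t. n \<ge> M \<Longrightarrow> t \<in> rspec A \<Longrightarrow> dist (poly (p n) t) (f t) < e/4"
    using uniform_limitD[OF p, of "e/4"] e by (auto simp: eventually_sequentially)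
  have "dist (poly_op (p m) A) (poly_op (p n) A) < e" if "m \<ge> M" "n \<ge> M" for m n
  proof -
    have "norm (poly_op (p m - p n) A) \<le> e/2"
    proof (intro norm_poly_op_le A)
      show "\<bar>poly (p m - p n) t\<bar> \<le> e/2" if "t \<in> rspec A" for t
        using M[OF \<open>m \<ge> M\<close> that] M[OF \<open>n \<ge> M\<close> that]
        unfolding dist_real_def poly_diff by linarith
    qed (use e in simp)
    then show ?thesis
      using e by (simp add: poly_op_diff dist_norm)
  qed
  then show "\<exists>M. \<forall>m\<ge>M. \<forall>n\<ge>M. dist (poly_op (p m) A) (poly_op (p n) A) < e"
    by blast
qed

text \<open>This resolves the definite description in \<open>fcalc\<close>: one approximating
  sequence \<open>q\<close> gives the limit \<open>L\<close>, and every other one shares it.\<close>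

lemma poly_op_tendsto_fcalc:
  assumes A: "A \<in> sa_ops" and f: "continuous_on (rspec A) f"
    and p: "uniform_limit (rspec A) (\<lambda>n. poly (p n)) f sequentially"
  shows "(\<lambda>n. poly_op (p n) A) \<longlonglongrightarrow> fcalc f A"
proof -
  obtain q :: "nat \<Rightarrow> real poly" where q: "uniform_limit (rspec A) (\<lambda>n. poly (q n)) f sequentially"
    using Ex_poly_uniform_limit[OF compact_rspec[OF A] f] by blast
  obtain L where L: "(\<lambda>n. poly_op (q n) A) \<longlonglongrightarrow> L"
    using complete_UNIV_blinfun poly_op_Cauchy[OF A q] unfolding complete_def by blast
  have lim: "(\<lambda>n. poly_op (r n) A) \<longlonglongrightarrow> L"
    if "uniform_limit (rspec A) (\<lambda>n. poly (r n)) f sequentially" for r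
    using tendsto_add[OF poly_op_diff_LIMSEQ[OF A that q] L] by simp
  have "fcalc f A = L"
    unfolding fcalc_def rspec_def[symmetric]
    using lim q L LIMSEQ_unique by (intro the_equality) blast+
  then show ?thesis
    using lim[OF p] by simp
qed

lemma fcalc_eqI:
  assumes "A \<in> sa_ops" "continuous_on (rspec A) f"
    "uniform_limit (rspec A) (\<lambda>n. poly (p n)) f sequentially" "(\<lambda>n. poly_op (p n) A) \<longlonglongrightarrow> T"
  shows "fcalc f A = T"
  using poly_op_tendsto_fcalc LIMSEQ_unique assms by blast

lemma fcalc_obtain_poly:
  assumes "A \<in> sa_ops" "continuous_on (rspec A) f"
  obtains p :: "nat \<Rightarrow> real poly" where
    "uniform_limit (rspec A) (\<lambda>n. poly (p n)) f sequentially" "(\<lambda>n. poly_op (p n) A) \<longlonglongrightarrow> fcalc f A"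
  using Ex_poly_uniform_limit[OF compact_rspec[OF assms(1)] assms(2)] poly_op_tendsto_fcalc[OF assms]
  by metis

text \<open>The definition sees the function only through uniform limits on
  \<open>rspec A\<close>.\<close>

lemma fcalc_cong:
  assumes "\<And>t. t \<in> rspec A \<Longrightarrow> f t = g t"
  shows "fcalc f A = fcalc g A"
proof -
  have "uniform_limit (rspec A) (\<lambda>n. poly (p n)) f sequentially
      \<longleftrightarrow> uniform_limit (rspec A) (\<lambda>n. poly (p n)) g sequentially" for p
    using assms by (intro uniform_limit_cong') auto
  then show ?thesis
    unfolding fcalc_def rspec_def[symmetric] by simp
qed

lemma fcalc_poly:
  assumes "A \<in> sa_ops"
  shows "fcalc (poly p) A = poly_op p A"
  by (rule fcalc_eqI[where p = "\<lambda>_. p"])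
    (auto simp: assms uniform_limit_const intro!: continuous_intros)

lemma fcalc_const:
  assumes "A \<in> sa_ops"
  shows "fcalc (\<lambda>_. c) A = c *\<^sub>R id_blinfun"
proof -
  have "poly [:c:] = (\<lambda>_. c)"
    by auto
  then show ?thesis
    using fcalc_poly[OF assms, of "[:c:]"] by (simp only: poly_op_const)
qed

lemma fcalc_ident:
  assumes "A \<in> sa_ops"
  shows "fcalc (\<lambda>t. t) A = A"
proof -
  have "poly [:0, 1:] = (\<lambda>t::real. t)"
    by auto
  then show ?thesis
    using fcalc_poly[OF assms, of "[:0, 1:]"] by (simp only: poly_op_ident)
qed

lemma fcalc_sa_ops:
  assumes "A \<in> sa_ops" "continuous_on (rspec A) f"
  shows "fcalc f A \<in> sa_ops"
  using fcalc_obtain_poly[OF assms] sa_ops_LIMSEQ poly_op_sa_ops assms by metis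

lemma fcalc_add:
  assumes A: "A \<in> sa_ops" and f: "continuous_on (rspec A) f" and g: "continuous_on (rspec A) g"
  shows "fcalc (\<lambda>t. f t + g t) A = fcalc f A + fcalc g A"
proof -
  obtain p where p: "uniform_limit (rspec A) (\<lambda>n. poly (p n)) f sequentially"
      "(\<lambda>n. poly_op (p n) A) \<longlonglongrightarrow> fcalc f A"
    using fcalc_obtain_poly[OF A f] by blast
  obtain q where q: "uniform_limit (rspec A) (\<lambda>n. poly (q n)) g sequentially"
      "(\<lambda>n. poly_op (q n) A) \<longlonglongrightarrow> fcalc g A"
    using fcalc_obtain_poly[OF A g] by blast
  show ?thesis
  proof (rule fcalc_eqI[OF A])
    show "uniform_limit (rspec A) (\<lambda>n. poly (p n + q n)) (\<lambda>t. f t + g t) sequentially"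
      unfolding poly_add by (intro uniform_limit_intros p q)
    show "(\<lambda>n. poly_op (p n + q n) A) \<longlonglongrightarrow> fcalc f A + fcalc g A"
      unfolding poly_op_add by (intro tendsto_intros p q)
  qed (intro continuous_intros f g)
qed

lemma fcalc_mult:
  assumes A: "A \<in> sa_ops" and f: "continuous_on (rspec A) f" and g: "continuous_on (rspec A) g"
  shows "fcalc (\<lambda>t. f t * g t) A = fcalc f A o\<^sub>L fcalc g A"
proof -
  obtain p where p: "uniform_limit (rspec A) (\<lambda>n. poly (p n)) f sequentially"
      "(\<lambda>n. poly_op (p n) A) \<longlonglongrightarrow> fcalc f A"
    using fcalc_obtain_poly[OF A f] by blast
  obtain q where q: "uniform_limit (rspec A) (\<lambda>n. poly (q n)) g sequentially"
      "(\<lambda>n. poly_op (q n) A) \<longlonglongrightarrow> fcalc g A"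
    using fcalc_obtain_poly[OF A g] by blast
  \<comment> \<open>Products of uniform limits converge uniformly when the limits are bounded, which
    compactness of the spectrum provides.\<close>
  have bounded: "bounded (f ` rspec A)" "bounded (g ` rspec A)"
    using f g compact_rspec[OF A] by (auto intro!: compact_imp_bounded compact_continuous_image)
  show ?thesis
  proof (rule fcalc_eqI[OF A])
    show "uniform_limit (rspec A) (\<lambda>n. poly (p n * q n)) (\<lambda>t. f t * g t) sequentially"
      unfolding poly_mult by (intro uniform_lim_mult p q bounded)
    show "(\<lambda>n. poly_op (p n * q n) A) \<longlonglongrightarrow> (fcalc f A o\<^sub>L fcalc g A)"
      unfolding poly_op_mult by (intro blinfun_compose.tendsto p q)
  qed (intro continuous_intros f g)
qed

lemma fcalc_cmult:
  assumes "A \<in> sa_ops" "continuous_on (rspec A) f"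
  shows "fcalc (\<lambda>t. c * f t) A = c *\<^sub>R fcalc f A"
  using fcalc_mult[OF assms(1) continuous_on_const assms(2)] assms
  by (simp add: fcalc_const blinfun_compose.scaleR_left)

lemma fcalc_diff:
  assumes "A \<in> sa_ops" "continuous_on (rspec A) f" "continuous_on (rspec A) g"
  shows "fcalc (\<lambda>t. f t - g t) A = fcalc f A - fcalc g A"
  using fcalc_add[OF assms(1,2), of "\<lambda>t. (-1) * g t"] fcalc_cmult[OF assms(1,3), of "-1"] assms
  by (simp add: continuous_on_minus)

lemma norm_fcalc_le:
  assumes A: "A \<in> sa_ops" and f: "continuous_on (rspec A) f"
    and "0 \<le> e" and e: "\<And>t. t \<in> rspec A \<Longrightarrow> \<bar>f t\<bar> \<le> e"
  shows "norm (fcalc f A) \<le> e"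
proof (rule field_le_epsilon)
  fix d :: real
  assume d: "0 < d"
  obtain p where p: "uniform_limit (rspec A) (\<lambda>n. poly (p n)) f sequentially"
      "(\<lambda>n. poly_op (p n) A) \<longlonglongrightarrow> fcalc f A"
    using fcalc_obtain_poly[OF A f] by blast
  show "norm (fcalc f A) \<le> e + d"
  proof (rule tendsto_upperbound)
    show "(\<lambda>n. norm (poly_op (p n) A)) \<longlonglongrightarrow> norm (fcalc f A)"
      by (intro tendsto_intros p)
    show "\<forall>\<^sub>F n in sequentially. norm (poly_op (p n) A) \<le> e + d"
      using uniform_limitD[OF p(1) d]
    proof eventually_elim
      case (elim n)
      have "\<bar>poly (p n) t\<bar> \<le> e + d" if "t \<in> rspec A" for t
        using elim e[OF that] that by (fastforce simp: dist_real_def)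
      then show ?case
        using d \<open>0 \<le> e\<close> by (intro norm_poly_op_le A) auto
    qed
  qed simp
qed

text \<open>If \<open>f\<close> omits \<open>s\<close> on the spectrum, the calculus of
  \<open>1 / (f t - s)\<close> inverts \<open>fcalc f A - s *\<^sub>R id_blinfun\<close>.\<close>

lemma rspec_fcalc:
  assumes A: "A \<in> sa_ops" and f: "continuous_on (rspec A) f"
  shows "rspec (fcalc f A) \<subseteq> f ` rspec A"
proof (rule subsetI, rule ccontr)
  fix s
  assume s: "s \<in> rspec (fcalc f A)" "s \<notin> f ` rspec A"
  define g where "g t = 1 / (f t - s)" for t
  have g: "continuous_on (rspec A) g"
    unfolding g_def using s by (intro continuous_intros f) auto
  have fs: "continuous_on (rspec A) (\<lambda>t. f t - s)"
    by (intro continuous_intros f)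
  have 1: "fcalc (\<lambda>t. f t - s) A = fcalc f A - s *\<^sub>R id_blinfun"
    using fcalc_diff[OF A f continuous_on_const] A by (simp add: fcalc_const)
  have 2: "fcalc h A = id_blinfun" if "\<And>t. t \<in> rspec A \<Longrightarrow> h t = 1" for h
    using fcalc_cong[of A h "\<lambda>_. 1"] that fcalc_const[OF A, of 1] by simp
  have "fcalc g A o\<^sub>L (fcalc f A - s *\<^sub>R id_blinfun) = id_blinfun"
    "(fcalc f A - s *\<^sub>R id_blinfun) o\<^sub>L fcalc g A = id_blinfun"
    unfolding 1[symmetric] fcalc_mult[OF A fs g, symmetric] fcalc_mult[OF A g fs, symmetric]
    using s by (auto intro!: 2 simp: g_def)
  then have "invertible_op (fcalc f A - s *\<^sub>R id_blinfun)"
    using sa_ops_minus_id[OF fcalc_sa_ops[OF A f]] invertible_opI by (auto simp: sa_ops_def)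
  then show False
    using s by (simp add: rspec_iff)
qed

text \<open>For polynomial \<open>g\<close> this is induction. In general \<open>g\<close> is
  approximated on the image of the spectrum, which contains the spectrum of
  \<open>fcalc f A\<close>, and \<open>norm_fcalc_le\<close> controls the error.\<close>

lemma fcalc_compose:
  assumes A: "A \<in> sa_ops" and f: "continuous_on (rspec A) f"
    and g: "continuous_on (f ` rspec A) g"
  shows "fcalc g (fcalc f A) = fcalc (\<lambda>t. g (f t)) A"
proof -
  have poly: "poly_op p (fcalc f A) = fcalc (\<lambda>t. poly p (f t)) A" for p
  proof (induction p)
    case 0
    show ?case
      using fcalc_const[OF A, of 0] by simp
  next
    case (pCons a p)
    have cont: "continuous_on (rspec A) (\<lambda>t. poly p (f t))"
      by (intro continuous_intros f)
    then show ?case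
      using pCons A f
      by (simp add: poly_op_pCons fcalc_add fcalc_mult fcalc_const continuous_on_mult)
  qed
  have gf: "continuous_on (rspec A) (\<lambda>t. g (f t))"
    using continuous_on_compose2[OF g f] by simp
  have "compact (f ` rspec A)"
    using f compact_rspec[OF A] by (rule compact_continuous_image)
  then obtain p :: "nat \<Rightarrow> real poly" where p: "uniform_limit (f ` rspec A) (\<lambda>n. poly (p n)) g sequentially"
    using Ex_poly_uniform_limit[OF _ g] by blast
  show ?thesis
  proof (rule fcalc_eqI[OF fcalc_sa_ops[OF A f]])
    show "continuous_on (rspec (fcalc f A)) g"
      using g rspec_fcalc[OF A f] by (rule continuous_on_subset)
    show "uniform_limit (rspec (fcalc f A)) (\<lambda>n. poly (p n)) g sequentially"
      using p rspec_fcalc[OF A f] by (rule uniform_limit_on_subset)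
    show "(\<lambda>n. poly_op (p n) (fcalc f A)) \<longlonglongrightarrow> fcalc (\<lambda>t. g (f t)) A"
      unfolding poly
    proof (rule tendstoI)
      fix e :: real
      assume e: "0 < e"
      then have "\<forall>\<^sub>F n in sequentially. \<forall>s\<in>f ` rspec A. dist (poly (p n) s) (g s) < e/2"
        using uniform_limitD[OF p, of "e/2"] by simp
      then show "\<forall>\<^sub>F n in sequentially. dist (fcalc (\<lambda>t. poly (p n) (f t)) A) (fcalc (\<lambda>t. g (f t)) A) < e"
      proof eventually_elim
        case (elim n)
        have cont: "continuous_on (rspec A) (\<lambda>t. poly (p n) (f t))"
          by (intro continuous_intros f)
        then have "norm (fcalc (\<lambda>t. poly (p n) (f t) - g (f t)) A) \<le> e/2"
          using e elim
          by (intro norm_fcalc_le A continuous_on_diff gf) (auto simp: dist_real_def intro: less_imp_le)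
        then show ?case
          using e by (simp add: fcalc_diff[OF A cont gf] dist_norm)
      qed
    qed
  qed
qed

subsection \<open>Powers and logarithms of positive definite operators\<close>

lemma posdef_sa_ops: "A \<in> posdef \<Longrightarrow> A \<in> sa_ops"
  by (simp add: posdef_iff)

text \<open>Invertibility excludes zero; for negative \<open>t\<close> the shifted operator is
  coercive. Powers and the logarithm are thus continuous on the spectrum.\<close>

lemma rspec_posdef:
  assumes A: "A \<in> posdef" and t: "t \<in> rspec A"
  shows "0 < t"
proof (rule ccontr)
  assume "\<not> 0 < t"
  then consider "t = 0" | "t < 0"
    by linarith
  then show False
  proof cases
    case 1
    then show ?thesis
      using assms by (simp add: rspec_iff posdef_iff)
  next
    case 2
    have "- t * (norm x)\<^sup>2 \<le> (A - t *\<^sub>R id_blinfun) x \<bullet> x" for x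
      using A by (simp add: posdef_iff blinfun.bilinear_simps inner_diff_left power2_norm_eq_inner)
    then have "invertible_op (A - t *\<^sub>R id_blinfun)"
      using 2 sa_ops_minus_id[OF posdef_sa_ops[OF A]]
      by (intro invertible_op_coercive[of _ "- t"]) (auto simp: sa_ops_def)
    then show ?thesis
      using t by (simp add: rspec_iff)
  qed
qed

lemma continuous_on_rspec_powr: "A \<in> posdef \<Longrightarrow> continuous_on (rspec A) (\<lambda>t. t powr r)"
  by (intro continuous_intros) (auto dest: rspec_posdef)

lemma continuous_on_rspec_ln: "A \<in> posdef \<Longrightarrow> continuous_on (rspec A) ln"
  by (intro continuous_intros) (auto dest: rspec_posdef)

lemma op_powr_sa_ops: "A \<in> posdef \<Longrightarrow> op_powr A r \<in> sa_ops"
  unfolding op_powr_def by (intro fcalc_sa_ops posdef_sa_ops continuous_on_rspec_powr)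

lemma op_powr_add: "A \<in> posdef \<Longrightarrow> op_powr A r o\<^sub>L op_powr A s = op_powr A (r + s)"
  unfolding op_powr_def powr_add
  by (subst fcalc_mult) (auto intro: posdef_sa_ops continuous_on_rspec_powr)

lemma op_powr_zero:
  assumes "A \<in> posdef"
  shows "op_powr A 0 = id_blinfun"
proof -
  have "op_powr A 0 = fcalc (\<lambda>_. 1) A"
    unfolding op_powr_def using rspec_posdef[OF assms] by (intro fcalc_cong) force
  then show ?thesis
    using fcalc_const[OF posdef_sa_ops[OF assms], of 1] by simp
qed

lemma op_powr_one:
  assumes "A \<in> posdef"
  shows "op_powr A 1 = A"
proof -
  have "op_powr A 1 = fcalc (\<lambda>t. t) A"
    unfolding op_powr_def using rspec_posdef[OF assms] by (intro fcalc_cong) force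
  then show ?thesis
    using fcalc_ident[OF posdef_sa_ops[OF assms]] by simp
qed

text \<open>The power is the square of the self-adjoint operator \<open>op_powr A (r/2)\<close>,
  hence positive, and \<open>op_powr A (- r)\<close> inverts it.\<close>

lemma op_powr_posdef:
  assumes A: "A \<in> posdef"
  shows "op_powr A r \<in> posdef"
proof -
  have "0 \<le> op_powr A r x \<bullet> x" for x
  proof -
    have "op_powr A r x \<bullet> x = op_powr A (r/2) (op_powr A (r/2) x) \<bullet> x"
      using op_powr_add[OF A, of "r/2" "r/2"] by (simp flip: blinfun_apply_blinfun_compose)
    also have "\<dots> = op_powr A (r/2) x \<bullet> op_powr A (r/2) x"
      by (rule sa_inner[OF op_powr_sa_ops[OF A]])
    finally show ?thesis
      by simp
  qed
  moreover have "invertible_op (op_powr A r)"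
    using op_powr_sa_ops[OF A, of r]
    by (intro invertible_opI[of _ "op_powr A (- r)"])
      (auto simp: op_powr_add[OF A] op_powr_zero[OF A] sa_ops_def)
  ultimately show ?thesis
    using op_powr_sa_ops[OF A] by (simp add: posdef_iff)
qed

lemma op_powr_powr:
  assumes A: "A \<in> posdef"
  shows "op_powr (op_powr A r) s = op_powr A (r * s)"
proof -
  have "continuous_on ((\<lambda>t. t powr r) ` rspec A) (\<lambda>t. t powr s)"
    by (intro continuous_intros) (auto dest: rspec_posdef[OF A])
  then show ?thesis
    using A unfolding op_powr_def
    by (subst fcalc_compose) (auto intro: posdef_sa_ops continuous_on_rspec_powr simp: powr_powr)
qed

lemma op_log_powr:
  assumes A: "A \<in> posdef"
  shows "op_log (op_powr A r) = r *\<^sub>R op_log A"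
proof -
  have "continuous_on ((\<lambda>t. t powr r) ` rspec A) ln"
    by (intro continuous_intros) (auto dest: rspec_posdef[OF A])
  then have "op_log (op_powr A r) = fcalc (\<lambda>t. ln (t powr r)) A"
    using A unfolding op_powr_def op_log_def
    by (intro fcalc_compose posdef_sa_ops continuous_on_rspec_powr)
  also have "\<dots> = fcalc (\<lambda>t. r * ln t) A"
    by (intro fcalc_cong) (auto simp: ln_powr dest: rspec_posdef[OF A])
  also have "\<dots> = r *\<^sub>R op_log A"
    using A unfolding op_log_def by (intro fcalc_cmult posdef_sa_ops continuous_on_rspec_ln)
  finally show ?thesis .
qed

lemma posdef_sandwich:
  assumes A: "A \<in> posdef" and B: "B \<in> posdef"
  shows "A o\<^sub>L B o\<^sub>L A \<in> posdef"
proof -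
  have "0 \<le> (A o\<^sub>L B o\<^sub>L A) x \<bullet> x" for x
    using B sa_inner[OF posdef_sa_ops[OF A], of "B (A x)" x] by (simp add: posdef_iff)
  then show ?thesis
    using assms by (auto simp: posdef_iff intro: sa_ops_sandwich invertible_op_compose)
qed

text \<open>This gives uniqueness of the positive definite square root, through the laws of
  exponents for \<open>X\<close>.\<close>

lemma op_powr_half_square:
  assumes "X \<in> posdef"
  shows "op_powr (X o\<^sub>L X) (1/2) = X"
proof -
  have "X o\<^sub>L X = op_powr X 2"
    using op_powr_add[OF assms, of 1 1] by (simp add: op_powr_one[OF assms])
  then show ?thesis
    by (simp add: op_powr_powr[OF assms] op_powr_one[OF assms])
qed

subsection \<open>The Riccati equation\<close>

lemma geo_mean_inverse:
  assumes "A \<in> posdef"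
  shows "geo_mean (op_powr A (-1)) B =
    op_powr A (-1/2) o\<^sub>L op_powr (op_powr A (1/2) o\<^sub>L B o\<^sub>L op_powr A (1/2)) (1/2) o\<^sub>L op_powr A (-1/2)"
  by (simp add: geo_mean_def op_powr_powr[OF assms])

lemma op_powr_half_cancel:
  assumes "A \<in> posdef"
  shows "op_powr A (1/2) o\<^sub>L op_powr A (1/2) = A"
    and "op_powr A (1/2) o\<^sub>L op_powr A (-1/2) = id_blinfun"
    and "op_powr A (-1/2) o\<^sub>L op_powr A (1/2) = id_blinfun"
  using op_powr_add[OF assms, of "1/2" "1/2"] op_powr_add[OF assms, of "1/2" "-1/2"]
    op_powr_add[OF assms, of "-1/2" "1/2"] by (simp_all add: op_powr_one op_powr_zero assms)

lemma geo_mean_inverse_posdef: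
  assumes "A \<in> posdef" "B \<in> posdef"
  shows "geo_mean (op_powr A (-1)) B \<in> posdef"
  unfolding geo_mean_inverse[OF assms(1)] by (intro posdef_sandwich op_powr_posdef assms)

text \<open>The mean is \<open>R o\<^sub>L W o\<^sub>L R\<close>, where
  \<open>R o\<^sub>L A o\<^sub>L R\<close> is the identity and \<open>W\<close> squares to
  \<open>Q o\<^sub>L B o\<^sub>L Q\<close>; the remaining factors \<open>R\<close> and
  \<open>Q\<close> cancel.\<close>

lemma geo_mean_inverse_Riccati:
  assumes A: "A \<in> posdef" and B: "B \<in> posdef"
  shows "geo_mean (op_powr A (-1)) B o\<^sub>L A o\<^sub>L geo_mean (op_powr A (-1)) B = B"
proof -
  define Q R where "Q = op_powr A (1/2)" and "R = op_powr A (-1/2)"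
  define W where "W = op_powr (Q o\<^sub>L B o\<^sub>L Q) (1/2)"
  have Z: "Q o\<^sub>L B o\<^sub>L Q \<in> posdef"
    unfolding Q_def by (intro posdef_sandwich op_powr_posdef A B)
  have QR: "Q o\<^sub>L Q = A" "Q o\<^sub>L R = id_blinfun" "R o\<^sub>L Q = id_blinfun"
    using op_powr_half_cancel[OF A] by (simp_all add: Q_def R_def)
  have "W o\<^sub>L W = Q o\<^sub>L B o\<^sub>L Q"
    unfolding W_def by (rule op_powr_half_cancel(1)[OF Z])
  then have "(R o\<^sub>L W o\<^sub>L R) o\<^sub>L A o\<^sub>L (R o\<^sub>L W o\<^sub>L R) = B"
    by (metis QR blinfun_compose_assoc blinfun_compose_id)
  then show ?thesis
    unfolding geo_mean_inverse[OF A] by (simp add: W_def Q_def R_def)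
qed

text \<open>With \<open>Q\<close> the root of \<open>A\<close>, the operator under the inner root is
  the square of the positive definite \<open>Q o\<^sub>L X o\<^sub>L Q\<close>, so the root is known
  and the outer factors cancel.\<close>

lemma geo_mean_inverse_unique:
  assumes A: "A \<in> posdef" and X: "X \<in> posdef"
  shows "geo_mean (op_powr A (-1)) (X o\<^sub>L A o\<^sub>L X) = X"
proof -
  define Q R where "Q = op_powr A (1/2)" and "R = op_powr A (-1/2)"
  have QR: "Q o\<^sub>L Q = A" "Q o\<^sub>L R = id_blinfun" "R o\<^sub>L Q = id_blinfun"
    using op_powr_half_cancel[OF A] by (simp_all add: Q_def R_def)
  have "Q o\<^sub>L (X o\<^sub>L A o\<^sub>L X) o\<^sub>L Q = (Q o\<^sub>L X o\<^sub>L Q) o\<^sub>L (Q o\<^sub>L X o\<^sub>L Q)"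
    unfolding QR(1)[symmetric] by (simp add: blinfun_compose_assoc)
  moreover have "Q o\<^sub>L X o\<^sub>L Q \<in> posdef"
    unfolding Q_def by (intro posdef_sandwich op_powr_posdef A X)
  ultimately have "op_powr (Q o\<^sub>L (X o\<^sub>L A o\<^sub>L X) o\<^sub>L Q) (1/2) = Q o\<^sub>L X o\<^sub>L Q"
    by (simp add: op_powr_half_square)
  moreover have "R o\<^sub>L (Q o\<^sub>L X o\<^sub>L Q) o\<^sub>L R = X"
    by (metis QR blinfun_compose_assoc blinfun_compose_id)
  ultimately show ?thesis
    unfolding geo_mean_inverse[OF A] by (simp add: Q_def R_def)
qed

text \<open>A midpoint must itself be a point of the cone on which the semi-metric lives.\<close>

lemma spectral_mean_posdef:
  assumes "A \<in> posdef" "B \<in> posdef"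
  shows "spectral_mean A B \<in> posdef"
  unfolding spectral_mean_def
  by (intro posdef_sandwich op_powr_posdef geo_mean_inverse_posdef assms)

lemma semi_metric_spectral_mean_left:
  assumes A: "A \<in> posdef" and B: "B \<in> posdef"
  shows "semi_metric A (spectral_mean A B) = 1/2 * semi_metric A B"
proof -
  note C = geo_mean_inverse_posdef[OF A B]
  show ?thesis
    unfolding semi_metric_def spectral_mean_def geo_mean_inverse_unique[OF A op_powr_posdef[OF C]]
      op_log_powr[OF C] by simp
qed

lemma semi_metric_spectral_mean_right:
  assumes A: "A \<in> posdef" and B: "B \<in> posdef"
  shows "semi_metric B (spectral_mean A B) = 1/2 * semi_metric A B"
proof -
  define C where "C = geo_mean (op_powr A (-1)) B"
  define D E where "D = op_powr C (1/2)" and "E = op_powr C (-1/2)"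
  have C: "C \<in> posdef"
    unfolding C_def by (rule geo_mean_inverse_posdef[OF A B])
  have DE: "D o\<^sub>L D = C" "D o\<^sub>L E = id_blinfun" "E o\<^sub>L D = id_blinfun"
    using op_powr_half_cancel[OF C] by (simp_all add: D_def E_def)
  have "C o\<^sub>L A o\<^sub>L C = B"
    unfolding C_def by (rule geo_mean_inverse_Riccati[OF A B])
  \<comment> \<open>Multiply the Riccati equation by \<open>E\<close> on both sides and use
    \<open>C = D o\<^sub>L D\<close>.\<close>
  then have "D o\<^sub>L A o\<^sub>L D = E o\<^sub>L B o\<^sub>L E"
    by (metis DE blinfun_compose_assoc blinfun_compose_id)
  then have "spectral_mean A B = E o\<^sub>L B o\<^sub>L E"
    by (simp add: spectral_mean_def C_def D_def)
  moreover have "geo_mean (op_powr B (-1)) (E o\<^sub>L B o\<^sub>L E) = E"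
    unfolding E_def by (rule geo_mean_inverse_unique[OF B op_powr_posdef[OF C]])
  ultimately have "semi_metric B (spectral_mean A B) = 2 * norm (op_log E)"
    by (simp add: semi_metric_def)
  \<comment> \<open>The logarithm of \<open>E\<close> is \<open>-1/2\<close> times that of
    \<open>C\<close>; the norm removes the sign.\<close>
  also have "\<dots> = 1/2 * semi_metric A B"
    unfolding E_def op_log_powr[OF C] by (simp add: semi_metric_def C_def)
  finally show ?thesis .
qed

end

theorem theorem2p9:
  fixes scale :: "'k::rc_field \<Rightarrow> 'v::{real_inner, complete_space} \<Rightarrow> 'v"
    and ip :: "'v \<Rightarrow> 'v \<Rightarrow> 'k"
    and A B :: "'v \<Rightarrow>\<^sub>L 'v"
  assumes "hilbert_space scale ip"
    and "A \<in> hilbert_space.posdef scale ip"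
    and "B \<in> hilbert_space.posdef scale ip"
  shows "hilbert_space.spectral_mean scale A B \<in> hilbert_space.posdef scale ip
    \<and> hilbert_space.semi_metric scale A (hilbert_space.spectral_mean scale A B)
        = 1/2 * hilbert_space.semi_metric scale A B
    \<and> hilbert_space.semi_metric scale B (hilbert_space.spectral_mean scale A B)
        = 1/2 * hilbert_space.semi_metric scale A B"
proof -
  interpret hilbert_space scale ip
    by (rule assms(1))
  show ?thesis
    using assms(2,3) spectral_mean_posdef semi_metric_spectral_mean_left
      semi_metric_spectral_mean_right by blast
qed

end
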